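(* Let $X,Y$ be Banach spaces, $F:D(F)\to Y$ a (possibly nonlinear) mapping with domain $D(F)\subseteq X$, $y^\dagger\in Y$, $\Omega:X\to(-\infty,\infty]$, and $E^\dagger:X\to[0,\infty)$. Assume: (A1) there is $x\in D(F)$ with $F(x)=y^\dagger$ and $\Omega(x)<\infty$; (A2) $F$ is weakly sequentially closed, i.e. for each sequence $(x_n)_{n\in\mathbb{N}}$ in $D(F)$, if $x_n\rightharpoonup x$ in $X$ and $F(x_n)\rightharpoonup y$ in $Y$, then $x\in D(F)$ and $F(x)=y$; (A3) $\Omega$ is convex; (A4) for every $c\in\mathbb{R}$ the sublevel set $\{x\in X:\Omega(x)\le c\}$ is weakly sequentially closed and each sequence in it has a weakly convergent subsequence. Let $\Omega^\dagger:=\min\{\Omega(x):x\in D(F),\,F(x)=y^\dagger\}$. Let further $\beta>0$ and $M\subseteq D(F)$ be such that: (E1) $M$ is weakly sequentially closed; (E2) $\beta\,E^\dagger(x^\ast)\le\Omega(x^\ast)-\Omega^\dagger$ for all $x^\ast\in M$ with $F(x^\ast)=y^\dagger$; (E3) the mapping $x\mapsto-\beta\,E^\dagger(x)+\Omega(x)$ is weakly sequentially lower semicontinuous on $M$; (E4) there are constants $\tilde\beta>\beta$ and $\tilde c\ge 0$ such that $\tilde\beta\,E^\dagger(x)-\Omega(x)\le\tilde c$ for all $x\in M$. Then there exists a concave index function $\varphi$ such that $$\beta\,E^\dagger(x)\le\Omega(x)-\Omega^\dagger+\varphi(\|F(x)-y^\dagger\|)\quad\text{for all }x\in M.$$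
   Context: An index function is a function $\varphi:[0,\infty)\to[0,\infty)$ that is continuous, monotonically increasing (nondecreasing), strictly increasing in a neighborhood of zero, and satisfies $\varphi(0)=0$. The symbol $\rightharpoonup$ denotes weak convergence. A set is weakly sequentially closed if it contains the limits of all its weakly convergent sequences. Assumptions (A1)–(A4) guarantee that the minimum defining $\Omega^\dagger$ exists. Inequalities involving the value $+\infty$ of $\Omega$ are understood in the extended real numbers. *)

theory Defs
  imports "HOL-Analysis.Analysis"
begin

text \<open>Weak convergence of sequences, tested with all continuous real-linear functionals. On a
  complex Banach space this is the usual notion as well, since the real parts of the continuous
  complex-linear functionals are exactly the continuous real-linear ones.\<close>

definition weakly_converges :: "(nat \<Rightarrow> 'a::real_normed_vector) \<Rightarrow> 'a \<Rightarrow> bool" where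
  "weakly_converges X x \<longleftrightarrow>
     (\<forall>f :: 'a \<Rightarrow> real. bounded_linear f \<longrightarrow> (\<lambda>n. f (X n)) \<longlonglongrightarrow> f x)"

definition weakly_seq_closed :: "'a::real_normed_vector set \<Rightarrow> bool" where
  "weakly_seq_closed S \<longleftrightarrow>
     (\<forall>X x. (\<forall>n. X n \<in> S) \<longrightarrow> weakly_converges X x \<longrightarrow> x \<in> S)"

text \<open>The limit of the subsequence is not required to lie in \<open>S\<close>.\<close>

definition weakly_seq_precompact :: "'a::real_normed_vector set \<Rightarrow> bool" where
  "weakly_seq_precompact S \<longleftrightarrow>
     (\<forall>X :: nat \<Rightarrow> 'a. (\<forall>n. X n \<in> S) \<longrightarrow> (\<exists>r x. strict_mono r \<and> weakly_converges (X \<circ> r) x))"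

text \<open>A partial mapping is given by a domain \<open>D\<close> together with a total function, whose values
  outside \<open>D\<close> are irrelevant.\<close>

definition weakly_seq_closed_map ::
    "'a::real_normed_vector set \<Rightarrow> ('a \<Rightarrow> 'b::real_normed_vector) \<Rightarrow> bool" where
  "weakly_seq_closed_map D F \<longleftrightarrow>
     (\<forall>X x y. (\<forall>n. X n \<in> D) \<longrightarrow> weakly_converges X x \<longrightarrow>
        weakly_converges (\<lambda>n. F (X n)) y \<longrightarrow> x \<in> D \<and> F x = y)"

definition weakly_seq_lsc_on :: "'a::real_normed_vector set \<Rightarrow> ('a \<Rightarrow> ereal) \<Rightarrow> bool" where
  "weakly_seq_lsc_on S f \<longleftrightarrow>
     (\<forall>X x. (\<forall>n. X n \<in> S) \<longrightarrow> x \<in> S \<longrightarrow> weakly_converges X x \<longrightarrow>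
        f x \<le> liminf (\<lambda>n. f (X n)))"

text \<open>Convexity of extended-real-valued functions (the library's \<^const>\<open>convex_on\<close> is for
  real-valued ones). It is meant for functions that avoid \<open>-\<infinity>\<close>, so that no
  sum \<open>\<infinity> + -\<infinity>\<close> occurs; note that \<open>0 * \<infinity> = 0\<close>.\<close>

definition ereal_convex :: "('a::real_vector \<Rightarrow> ereal) \<Rightarrow> bool" where
  "ereal_convex f \<longleftrightarrow>
     (\<forall>x y. \<forall>u\<ge>0. \<forall>v\<ge>0. u + v = 1 \<longrightarrow>
        f (u *\<^sub>R x + v *\<^sub>R y) \<le> ereal u * f x + ereal v * f y)"

text \<open>\<^const>\<open>Least\<close> denotes the minimum of the set of values whenever it is attained, and is
  unspecified otherwise.\<close>

definition min_value :: "('a \<Rightarrow> ereal) \<Rightarrow> 'a set \<Rightarrow> ereal" where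
  "min_value f S = (LEAST v. v \<in> f ` S)"

text \<open>Functions on \<open>[0,\<infinity>)\<close> are total functions considered on \<^term>\<open>{0::real..}\<close> only.\<close>

definition index_function :: "(real \<Rightarrow> real) \<Rightarrow> bool" where
  "index_function \<phi> \<longleftrightarrow>
     (\<forall>t\<ge>0. \<phi> t \<ge> 0) \<and> continuous_on {0..} \<phi> \<and> mono_on {0..} \<phi> \<and>
     (\<exists>\<delta>>0. strict_mono_on {0..<\<delta>} \<phi>) \<and> \<phi> 0 = 0"

end

theory Submission
  imports Defs
begin

text \<open>On the points of \<open>M\<close> where \<open>\<Omega>\<close> is finite put
  \<open>g x = \<beta> * Edag x - \<Omega> x + \<Omega>dag\<close>. By (E4), \<open>g\<close> is bounded above, and \<open>\<Omega>\<close> is bounded on each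
  set \<open>{x. g x \<ge> e}\<close>. Hence a sequence with \<open>g \<ge> e > 0\<close> along which \<open>F\<close> tends to \<open>ydag\<close> has a weakly
  convergent subsequence; its limit \<open>x\<close> lies in \<open>M\<close>, satisfies \<open>F x = ydag\<close>, and contradicts (E2)
  by (E3). So \<open>g x\<close> is at most \<open>e\<close> as soon as \<open>norm (F x - ydag)\<close> is at most some \<open>\<delta> e\<close>, and the
  infimum over \<open>e\<close> of the affine functions \<open>t \<mapsto> e + K / \<delta> e * t\<close>, with \<open>K\<close> a bound of \<open>g\<close>, is a
  concave majorant vanishing at \<open>0\<close>; adding \<open>t\<close> makes it strictly increasing.\<close>

lemma weakly_converges_subseq:
  assumes "weakly_converges X x" "strict_mono r"
  shows "weakly_converges (X \<circ> r) x"
  using assms unfolding weakly_converges_def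
  by (auto simp: o_def intro: LIMSEQ_subseq_LIMSEQ[unfolded o_def])

lemma tendsto_imp_weakly_converges:
  assumes "X \<longlonglongrightarrow> x"
  shows "weakly_converges X x"
  using assms unfolding weakly_converges_def by (auto intro: bounded_linear.tendsto)

lemma weakly_seq_closed_eventually:
  assumes "weakly_seq_closed S" "weakly_converges X x" "eventually (\<lambda>n. X n \<in> S) sequentially"
  shows "x \<in> S"
proof -
  obtain N where N: "\<And>n. n \<ge> N \<Longrightarrow> X n \<in> S"
    using assms(3) by (auto simp: eventually_sequentially)
  have "strict_mono (\<lambda>n. n + N)"
    by (simp add: strict_mono_def)
  from weakly_converges_subseq[OF assms(2) this] have "weakly_converges (X \<circ> (\<lambda>n. n + N)) x" .
  moreover have "\<forall>n. (X \<circ> (\<lambda>n. n + N)) n \<in> S"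
    using N by simp
  ultimately show ?thesis
    using assms(1) unfolding weakly_seq_closed_def by blast
qed

text \<open>The compactness argument, used for a minimizing sequence and later for a sequence
  violating smallness. Norm convergence of the values of \<open>F\<close> is in particular weak, so
  the closedness of \<open>F\<close> identifies the limit as an exact solution.\<close>

lemma weak_limit_of_approximate_solutions:
  assumes "weakly_seq_closed_map D F" "weakly_seq_precompact S"
    and "\<And>n. X n \<in> D" "\<And>n. X n \<in> S" "(\<lambda>n. F (X n)) \<longlonglongrightarrow> y"
  obtains r x where "strict_mono r" "weakly_converges (X \<circ> r) x" "x \<in> D" "F x = y"
proof -
  obtain r x where r: "strict_mono r" and x: "weakly_converges (X \<circ> r) x"
    using assms(2,4) unfolding weakly_seq_precompact_def by blast
  have "weakly_converges (\<lambda>n. F ((X \<circ> r) n)) y"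
    using LIMSEQ_subseq_LIMSEQ[OF assms(5) r]
    by (intro tendsto_imp_weakly_converges) (simp add: o_def)
  moreover have "\<forall>n. (X \<circ> r) n \<in> D"
    using assms(3) by simp
  ultimately have "x \<in> D \<and> F x = y"
    using assms(1)[unfolded weakly_seq_closed_map_def, rule_format, of "X \<circ> r" x y] x by simp
  with r x show ?thesis by (intro that) auto
qed

text \<open>Direct method: a minimizing sequence ends up in one sublevel set, a weak limit of a
  subsequence is again a solution, and the closed sublevel sets keep its value down to the infimum.
  Attainment is what gives the \<open>LEAST\<close> in \<open>min_value\<close> its meaning.\<close>

lemma min_value_attained:
  fixes \<Omega> :: "'a::real_normed_vector \<Rightarrow> ereal"
  assumes dom: "\<exists>x\<in>D. F x = y \<and> \<Omega> x < \<infinity>"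
    and F: "weakly_seq_closed_map D F"
    and closed: "\<And>c::real. weakly_seq_closed {x. \<Omega> x \<le> ereal c}"
    and precompact: "\<And>c::real. weakly_seq_precompact {x. \<Omega> x \<le> ereal c}"
  obtains x where "x \<in> D" "F x = y" "min_value \<Omega> {x \<in> D. F x = y} = \<Omega> x" "\<Omega> x < \<infinity>"
proof -
  define S where "S = {x \<in> D. F x = y}"
  define m where "m = Inf (\<Omega> ` S)"
  obtain x0 where x0: "x0 \<in> S" "\<Omega> x0 < \<infinity>"
    using dom by (auto simp: S_def)
  have "m \<le> \<Omega> x0"
    unfolding m_def using x0 by (intro Inf_lower) auto
  then have m_fin: "m < \<infinity>"
    using x0 by auto
  \<comment> \<open>Any real level above \<open>m\<close> will do; \<open>m\<close> itself may still
    be -\<infinity> here.\<close>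
  obtain c :: real where c: "m < ereal c"
    using ereal_dense2[OF m_fin] by blast
  obtain u where u: "\<And>n. u n \<in> \<Omega> ` S" "u \<longlonglongrightarrow> m"
    using Inf_as_limit[of "\<Omega> ` S"] x0 unfolding m_def by auto
  have "\<forall>n. \<exists>x. x \<in> S \<and> \<Omega> x = u n"
    using u(1) by (metis imageE)
  then obtain X where X: "\<And>n. X n \<in> S" "\<And>n. \<Omega> (X n) = u n"
    by metis
  obtain N where N: "\<And>n. n \<ge> N \<Longrightarrow> u n < ereal c"
    using order_tendstoD(2)[OF u(2) c] by (auto simp: eventually_sequentially)
  \<comment> \<open>Dropping the first \<open>N\<close> terms puts the whole sequence into the
    sublevel set of \<open>c\<close>, as precompactness demands.\<close>
  define Y where "Y n = X (n + N)" for n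
  have Y: "\<Omega> (Y n) \<le> ereal c" for n
    using N[of "n + N"] X(2)[of "n + N"] by (simp add: Y_def)
  have YS: "Y n \<in> D" "F (Y n) = y" for n
    using X(1)[of "n + N"] by (auto simp: Y_def S_def)
  have lim: "(\<lambda>n. F (Y n)) \<longlonglongrightarrow> y"
    by (simp add: YS)
  obtain r x where r: "strict_mono r" and x: "weakly_converges (Y \<circ> r) x" "x \<in> D" "F x = y"
    by (rule weak_limit_of_approximate_solutions[OF F precompact[of c], of Y y])
       (use YS Y lim in auto)
  have "(\<lambda>n. u (n + N)) \<longlonglongrightarrow> m"
    using u(2) by (rule LIMSEQ_ignore_initial_segment)
  then have \<Omega>Y: "(\<lambda>n. \<Omega> ((Y \<circ> r) n)) \<longlonglongrightarrow> m"
    using LIMSEQ_subseq_LIMSEQ[OF _ r, of "\<lambda>n. u (n + N)" m] by (simp add: o_def Y_def X(2))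
  \<comment> \<open>Lower semicontinuity from closed sublevel sets: a level \<open>b\<close>
    strictly between \<open>m\<close> and \<open>\<Omega> x\<close> would contain a tail of the
    sequence, hence also \<open>x\<close>.\<close>
  have le: "\<Omega> x \<le> m"
  proof (rule ccontr)
    assume "\<not> \<Omega> x \<le> m"
    then obtain b :: real where b: "m < ereal b" "ereal b < \<Omega> x"
      using ereal_dense2[of m "\<Omega> x"] unfolding not_le by blast
    have "eventually (\<lambda>n. (Y \<circ> r) n \<in> {x. \<Omega> x \<le> ereal b}) sequentially"
      using order_tendstoD(2)[OF \<Omega>Y b(1)] by eventually_elim auto
    then have "x \<in> {x. \<Omega> x \<le> ereal b}"
      by (rule weakly_seq_closed_eventually[OF closed x(1)])
    with b(2) show False by simp
  qed
  have "min_value \<Omega> S = \<Omega> x"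
    unfolding min_value_def
  proof (rule Least_equality)
    show "\<Omega> x \<in> \<Omega> ` S"
      using x by (auto simp: S_def)
    show "\<Omega> x \<le> v" if "v \<in> \<Omega> ` S" for v
      using le Inf_lower[OF that] by (simp add: m_def)
  qed
  with x le m_fin show ?thesis
    unfolding S_def by (intro that[of x]) auto
qed

text \<open>Only upper bounds on \<open>g\<close> matter: \<open>small\<close> controls it near
  \<open>d x = 0\<close>, and \<open>bound\<close> allows a steep enough line to control it
  elsewhere.\<close>

lemma concave_index_majorant:
  fixes g d :: "'i \<Rightarrow> real"
  assumes bound: "\<And>x. x \<in> A \<Longrightarrow> g x \<le> C"
    and d: "\<And>x. x \<in> A \<Longrightarrow> d x \<ge> 0"
    and small: "\<And>e. e > 0 \<Longrightarrow> \<exists>\<delta>>0. \<forall>x\<in>A. d x \<le> \<delta> \<longrightarrow> g x \<le> e"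
  shows "\<exists>\<phi>. index_function \<phi> \<and> concave_on {0..} \<phi> \<and> (\<forall>x\<in>A. g x \<le> \<phi> (d x))"
proof -
  obtain \<delta> where \<delta>: "\<And>e. e > 0 \<Longrightarrow> \<delta> e > 0"
    and g\<delta>: "\<And>e x. e > 0 \<Longrightarrow> x \<in> A \<Longrightarrow> d x \<le> \<delta> e \<Longrightarrow> g x \<le> e"
    using small by metis
  \<comment> \<open>The absolute value keeps the slopes nonnegative even for negative
    \<open>C\<close>.\<close>
  define K where "K = \<bar>C\<bar>"
  define l where "l e t = e + K / \<delta> e * t" for e t :: real
  define \<psi> where "\<psi> t = (INF e\<in>{0<..}. l e t)" for t :: real
  define \<phi> where "\<phi> t = t + \<psi> t" for t :: real
  have slope: "K / \<delta> e \<ge> 0" if "e > 0" for e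
    using \<delta>[OF that] by (simp add: K_def)
  have l_nonneg: "l e t \<ge> 0" if "e > 0" "t \<ge> 0" for e t
    unfolding l_def using slope that by (intro add_nonneg_nonneg mult_nonneg_nonneg) auto
  have bdd: "bdd_below ((\<lambda>e. l e t) ` {0<..})" if "t \<ge> 0" for t
    using l_nonneg that by (intro bdd_belowI[of _ 0]) auto
  have \<psi>_le: "\<psi> t \<le> l e t" if "e > 0" "t \<ge> 0" for e t
    unfolding \<psi>_def using that by (intro cINF_lower bdd) auto
  have \<psi>_ge: "b \<le> \<psi> t" if "\<And>e. e > 0 \<Longrightarrow> b \<le> l e t" for b t
    unfolding \<psi>_def using that by (intro cINF_greatest) auto
  have \<psi>_nonneg: "\<psi> t \<ge> 0" if "t \<ge> 0" for t
    using that l_nonneg by (intro \<psi>_ge) auto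
  have \<psi>_mono: "\<psi> s \<le> \<psi> t" if "0 \<le> s" "s \<le> t" for s t
  proof (rule \<psi>_ge)
    fix e :: real assume e: "e > 0"
    have "\<psi> s \<le> l e s" using e that by (intro \<psi>_le)
    also have "\<dots> \<le> l e t"
      unfolding l_def using slope[OF e] that by (intro add_left_mono mult_left_mono)
    finally show "\<psi> s \<le> l e t" .
  qed
  \<comment> \<open>The slopes may blow up as \<open>e\<close> tends to 0, but at
    \<open>t = 0\<close> they drop out.\<close>
  have "\<psi> 0 \<le> e" if "e > 0" for e
    using \<psi>_le[OF that, of 0] by (simp add: l_def)
  then have "\<psi> 0 \<le> 0"
    by (rule field_le_epsilon) simp
  with \<psi>_nonneg[of 0] have \<psi>0: "\<psi> 0 = 0"
    by simp
  have conc: "concave_on {0..} \<phi>"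
    unfolding concave_on_iff
  proof (intro conjI ballI allI impI)
    show "convex {0::real..}" by simp
    fix x y u v :: real
    assume xy: "x \<in> {0..}" "y \<in> {0..}" and uv: "0 \<le> u" "0 \<le> v" "u + v = 1"
    have "u * \<psi> x + v * \<psi> y \<le> \<psi> (u * x + v * y)"
    proof (rule \<psi>_ge)
      fix e :: real assume e: "e > 0"
      have "u * \<psi> x + v * \<psi> y \<le> u * l e x + v * l e y"
        using \<psi>_le[OF e] xy uv by (intro add_mono mult_left_mono) auto
      also have "\<dots> = (u + v) * e + K / \<delta> e * (u * x + v * y)"
        by (simp add: l_def algebra_simps)
      also have "\<dots> = l e (u * x + v * y)"
        by (simp add: uv l_def)
      finally show "u * \<psi> x + v * \<psi> y \<le> l e (u * x + v * y)" .
    qed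
    then show "u * \<phi> x + v * \<phi> y \<le> \<phi> (u *\<^sub>R x + v *\<^sub>R y)"
      by (simp add: \<phi>_def algebra_simps)
  qed
  have strict: "\<phi> s < \<phi> t" if "0 \<le> s" "s < t" for s t
    using \<psi>_mono[of s t] that by (simp add: \<phi>_def)
  have cont: "continuous_on {0..} \<phi>"
    unfolding continuous_on_eq_continuous_within
  proof
    fix t :: real assume "t \<in> {0..}"
    \<comment> \<open>Concavity yields continuity only on the open half-line; the endpoint needs its
      own argument.\<close>
    then consider "t > 0" | "t = 0" by fastforce
    then show "continuous (at t within {0..}) \<phi>"
    proof cases
      case 1
      have "convex_on {0<..} (\<lambda>t. - \<phi> t)"
        using conc unfolding concave_on_def
        by (rule convex_on_subset) (auto intro: convex_real_interval)
      then have "continuous_on {0<..} (\<lambda>t. - \<phi> t)"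
        by (intro convex_on_continuous) auto
      then have "continuous_on {0<..} \<phi>"
        using continuous_on_minus[of "{0<..}" "\<lambda>t. - \<phi> t"] by simp
      then have "isCont \<phi> t"
        using 1 by (simp add: continuous_on_eq_continuous_at)
      then show ?thesis
        by (rule continuous_at_imp_continuous_at_within)
    next
      case 2
      have "(\<phi> \<longlongrightarrow> 0) (at 0 within {0..})"
      proof (rule order_tendstoI)
        fix b :: real assume b: "b < 0"
        show "eventually (\<lambda>t. b < \<phi> t) (at 0 within {0..})"
          unfolding eventually_at_filter
        proof (intro always_eventually allI impI)
          fix t :: real assume "t \<in> {0..}"
          then show "b < \<phi> t"
            using \<psi>_nonneg[of t] b by (simp add: \<phi>_def)
        qed
      next
        fix b :: real assume b: "b > 0"
        \<comment> \<open>A single affine majorant of \<open>\<phi>\<close> suffices: for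
          \<open>e = b / 2\<close> its limit at 0 is \<open>b / 2 < b\<close>.\<close>
        have "((\<lambda>t. t + l (b / 2) t) \<longlongrightarrow> 0 + l (b / 2) 0) (at 0 within {0..})"
          unfolding l_def by (intro tendsto_intros)
        then have "eventually (\<lambda>t. t + l (b / 2) t < b) (at 0 within {0..})"
          by (rule order_tendstoD) (use b in \<open>simp add: l_def\<close>)
        moreover have "eventually (\<lambda>t. t \<in> {0::real..}) (at 0 within {0..})"
          by (auto simp: eventually_at_filter)
        ultimately show "eventually (\<lambda>t. \<phi> t < b) (at 0 within {0..})"
        proof eventually_elim
          case (elim t)
          then show ?case
            using \<psi>_le[of "b / 2" t] b by (simp add: \<phi>_def)
        qed
      qed
      then show ?thesis
        using 2 \<psi>0 by (simp add: continuous_within \<phi>_def)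
    qed
  qed
  have "g x \<le> \<phi> (d x)" if x: "x \<in> A" for x
  proof -
    have "g x \<le> \<psi> (d x)"
    proof (rule \<psi>_ge)
      fix e :: real assume e: "e > 0"
      show "g x \<le> l e (d x)"
      \<comment> \<open>Up to \<open>\<delta> e\<close> the constant term \<open>e\<close> already
        dominates \<open>g x\<close>; beyond it the linear term exceeds \<open>K\<close>.\<close>
      proof (cases "d x \<le> \<delta> e")
        case True
        then have "g x \<le> e" using g\<delta> e x by blast
        also have "e \<le> l e (d x)"
          using mult_nonneg_nonneg[OF slope[OF e] d[OF x]] by (simp add: l_def)
        finally show ?thesis .
      next
        case False
        have "g x \<le> K" using bound[OF x] by (simp add: K_def)
        also have "K = K / \<delta> e * \<delta> e" using \<delta>[OF e] by simp
        also have "\<dots> \<le> K / \<delta> e * d x"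
          using False slope[OF e] by (intro mult_left_mono) auto
        also have "\<dots> \<le> l e (d x)" using e by (simp add: l_def)
        finally show ?thesis .
      qed
    qed
    then show ?thesis using d[OF x] by (simp add: \<phi>_def)
  qed
  moreover have "index_function \<phi>"
    unfolding index_function_def
  proof (intro conjI)
    show "\<forall>t\<ge>0. 0 \<le> \<phi> t"
      using \<psi>_nonneg by (simp add: \<phi>_def)
    show "mono_on {0..} \<phi>"
      using \<psi>_mono by (auto simp: \<phi>_def intro!: mono_onI add_mono)
    show "\<exists>\<delta>>0. strict_mono_on {0..<\<delta>} \<phi>"
      using strict by (intro exI[of _ 1]) (auto intro!: strict_mono_onI)
    show "\<phi> 0 = 0"
      by (simp add: \<phi>_def \<psi>0)
  qed (rule cont)
  ultimately show ?thesis using conc by blast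
qed

theorem theorem5:
  fixes D M :: "'a::banach set"
    and F :: "'a \<Rightarrow> 'b::banach"
    and ydag :: 'b
    and \<Omega> :: "'a \<Rightarrow> ereal"
    and Edag :: "'a \<Rightarrow> real"
    and \<beta> :: real
    and \<Omega>dag :: ereal
  assumes \<Omega>_range: "\<And>x. \<Omega> x \<noteq> -\<infinity>"
    and Edag_range: "\<And>x. Edag x \<ge> 0"
    and A1: "\<exists>x\<in>D. F x = ydag \<and> \<Omega> x < \<infinity>"
    and A2: "weakly_seq_closed_map D F"
    and A3: "ereal_convex \<Omega>"
    and A4: "\<And>c::real. weakly_seq_closed {x. \<Omega> x \<le> ereal c} \<and>
                weakly_seq_precompact {x. \<Omega> x \<le> ereal c}"
    and \<Omega>dag: "\<Omega>dag = min_value \<Omega> {x \<in> D. F x = ydag}"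
    and \<beta>: "\<beta> > 0"
    and M: "M \<subseteq> D"
    and E1: "weakly_seq_closed M"
    and E2: "\<And>x. x \<in> M \<Longrightarrow> F x = ydag \<Longrightarrow> ereal (\<beta> * Edag x) \<le> \<Omega> x - \<Omega>dag"
    and E3: "weakly_seq_lsc_on M (\<lambda>x. ereal (- \<beta> * Edag x) + \<Omega> x)"
    and E4: "\<exists>\<beta>' > \<beta>. \<exists>c\<ge>0. \<forall>x\<in>M. ereal (\<beta>' * Edag x) - \<Omega> x \<le> ereal c"
  shows "\<exists>\<phi>. index_function \<phi> \<and> concave_on {0..} \<phi> \<and>
           (\<forall>x\<in>M. ereal (\<beta> * Edag x) \<le> \<Omega> x - \<Omega>dag + ereal (\<phi> (norm (F x - ydag))))"
proof -
  obtain xd where xd: "\<Omega>dag = \<Omega> xd" "\<Omega> xd < \<infinity>"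
    using min_value_attained[OF A1 A2] A4 \<Omega>dag by metis
  then obtain w where w: "\<Omega>dag = ereal w"
    using \<Omega>_range[of xd] by (cases "\<Omega> xd") auto
  obtain \<beta>' c where \<beta>': "\<beta>' > \<beta>"
    and E4': "\<And>x. x \<in> M \<Longrightarrow> ereal (\<beta>' * Edag x) - \<Omega> x \<le> ereal c"
    using E4 by blast
  \<comment> \<open>Where \<open>\<Omega>\<close> is infinite the claim is trivial.
    \<open>real_of_ereal\<close> sends \<infinity> to 0, so \<open>p\<close> and \<open>g\<close>
    are meaningful on \<open>A\<close> only.\<close>
  define A where "A = {x \<in> M. \<Omega> x < \<infinity>}"
  define p where "p x = real_of_ereal (\<Omega> x)" for x
  define g where "g x = \<beta> * Edag x - p x + w" for x
  define d where "d x = norm (F x - ydag)" for x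
  have p: "\<Omega> x = ereal (p x)" if "x \<in> A" for x
    using that \<Omega>_range[of x] by (cases "\<Omega> x") (auto simp: A_def p_def)
  have p_ge: "\<beta>' * Edag x \<le> c + p x" if "x \<in> A" for x
    using E4'[of x] that p[OF that] by (simp add: A_def)
  have g_bound: "g x \<le> c + w" if "x \<in> A" for x
    using p_ge[OF that] mult_right_mono[of \<beta> \<beta>' "Edag x"] \<beta>' Edag_range[of x] by (simp add: g_def)
  have small: "\<exists>\<delta>>0. \<forall>x\<in>A. d x \<le> \<delta> \<longrightarrow> g x \<le> e" if e: "e > 0" for e
  proof (rule ccontr)
    assume "\<not> ?thesis"
    then have "\<forall>n. \<exists>x. x \<in> A \<and> d x \<le> inverse (real (Suc n)) \<and> g x > e"
      by (metis inverse_positive_iff_positive not_le of_nat_0_less_iff zero_less_Suc)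
    then obtain X where X: "\<And>n. X n \<in> A" "\<And>n. d (X n) \<le> inverse (real (Suc n))" "\<And>n. g (X n) > e"
      by metis
    \<comment> \<open>From \<open>g (X n) > 0\<close> follows
      \<open>p (X n) \<le> \<beta> * Edag (X n) + w\<close>. Inserted into \<open>p_ge\<close>, this
      bounds \<open>Edag (X n)\<close> thanks to the gap between \<open>\<beta>\<close> and
      \<open>\<beta>'\<close>, and then bounds \<open>p (X n)\<close> by \<open>b\<close>.\<close>
    define b where "b = \<beta> * ((c + w) / (\<beta>' - \<beta>)) + w"
    have level: "\<Omega> (X n) \<le> ereal b" for n
    proof -
      have pn: "p (X n) \<le> \<beta> * Edag (X n) + w"
        using X(3)[of n] e by (simp add: g_def)
      then have "(\<beta>' - \<beta>) * Edag (X n) \<le> c + w"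
        using p_ge[OF X(1)[of n]] by (simp add: algebra_simps)
      then have "Edag (X n) \<le> (c + w) / (\<beta>' - \<beta>)"
        using \<beta>' by (simp add: pos_le_divide_eq mult.commute)
      then have "\<beta> * Edag (X n) \<le> \<beta> * ((c + w) / (\<beta>' - \<beta>))"
        using \<beta> by (intro mult_left_mono) auto
      with pn have "p (X n) \<le> b" by (simp add: b_def)
      then show ?thesis using p[OF X(1)[of n]] by simp
    qed
    have "(\<lambda>n. d (X n)) \<longlonglongrightarrow> 0"
      by (rule tendsto_sandwich[OF _ _ tendsto_const LIMSEQ_inverse_real_of_nat])
         (use X(2) in \<open>auto simp: d_def\<close>)
    then have lim: "(\<lambda>n. F (X n)) \<longlonglongrightarrow> ydag"
      unfolding d_def by (rule tendsto_norm_zero_cancel[THEN LIM_zero_cancel])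
    have XM: "X n \<in> M" "X n \<in> D" for n
      using X(1)[of n] M by (auto simp: A_def)
    obtain r x where r: "strict_mono r" and x: "weakly_converges (X \<circ> r) x" "F x = ydag"
      by (rule weak_limit_of_approximate_solutions[OF A2 conjunct2[OF A4[of b]], of X ydag])
         (use XM level lim in auto)
    have xM: "x \<in> M"
      using E1[unfolded weakly_seq_closed_def, rule_format, OF _ x(1)] XM by simp
    \<comment> \<open>Along the sequence \<open>g > e\<close> says that this functional stays below
      \<open>w - e\<close>, and by \<open>E3\<close> so does its value at \<open>x\<close>. But
      \<open>x\<close> is a solution in \<open>M\<close>, where \<open>E2\<close> forces the value
      to be at least \<open>w\<close>.\<close>
    have "ereal (- \<beta> * Edag x) + \<Omega> x
        \<le> liminf (\<lambda>n. ereal (- \<beta> * Edag ((X \<circ> r) n)) + \<Omega> ((X \<circ> r) n))"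
      using E3[unfolded weakly_seq_lsc_on_def, rule_format, OF _ xM x(1)] XM by simp
    also have "\<dots> \<le> ereal (w - e)"
    proof (rule Liminf_le)
      show "eventually (\<lambda>n. ereal (- \<beta> * Edag ((X \<circ> r) n)) + \<Omega> ((X \<circ> r) n) \<le> ereal (w - e))
          sequentially"
      proof (rule always_eventually, rule allI)
        fix n
        show "ereal (- \<beta> * Edag ((X \<circ> r) n)) + \<Omega> ((X \<circ> r) n) \<le> ereal (w - e)"
          using X(3)[of "r n"] p[OF X(1)[of "r n"]] by (simp add: g_def)
      qed
    qed simp
    finally have "ereal (- \<beta> * Edag x) + \<Omega> x \<le> ereal (w - e)" .
    moreover have "ereal (\<beta> * Edag x) \<le> \<Omega> x - ereal w"
      using E2[OF xM x(2)] w by simp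
    ultimately show False
      using e by (cases "\<Omega> x") auto
  qed
  obtain \<phi> where \<phi>: "index_function \<phi>" "concave_on {0..} \<phi>" "\<And>x. x \<in> A \<Longrightarrow> g x \<le> \<phi> (d x)"
    using concave_index_majorant[of A g "c + w" d] g_bound small by (auto simp: d_def)
  have "ereal (\<beta> * Edag x) \<le> \<Omega> x - \<Omega>dag + ereal (\<phi> (norm (F x - ydag)))" if "x \<in> M" for x
  proof (cases "x \<in> A")
    case True
    then show ?thesis
      using \<phi>(3)[OF True] p[OF True] w by (simp add: g_def d_def)
  next
    case False
    then have "\<Omega> x = \<infinity>" using that by (auto simp: A_def)
    then show ?thesis using w by simp
  qed
  with \<phi>(1,2) show ?thesis by blast
qed

end
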